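(* Let $\dot x=P(x,y),\ \dot y=Q(x,y)$ be a quasi-homogeneous but non-homogeneous polynomial differential system of degree $n$ with minimal weight vector $(s_1,s_2,d)$. Then there is a suitable positive integer $\beta$ such that the system is transformed into a homogeneous polynomial differential system by a change of variables of the form $$\tilde x=(\pm x)^{s_2/\beta},\qquad \tilde y=(\pm y)^{s_1/\beta}$$ (on each open quadrant, the signs being chosen according to the signs of $x$ and $y$ so that the bases are positive), composed with a time rescaling.
   Context: Consider real planar polynomial systems $\dot x=P(x,y)$, $\dot y=Q(x,y)$ with $P,Q\in\mathbb R[x,y]$, $PQ\not\equiv0$, the origin being a singularity, and $P,Q$ having no non-constant common factor. The degree of the system is $n=\max\{\deg P,\deg Q\}$. The system is quasi-homogeneous if there exist positive integers $s_1,s_2,d$ such that for all $\alpha>0$ $$P(\alpha^{s_1}x,\alpha^{s_2}y)=\alpha^{s_1+d-1}P(x,y),\qquad Q(\alpha^{s_1}x,\alpha^{s_2}y)=\alpha^{s_2+d-1}Q(x,y).$$ Then $(s_1,s_2,d)$ is called a weight vector of the system. A weight vector $(\tilde s_1,\tilde s_2,\tilde d)$ is minimal if every other weight vector $(s_1,s_2,d)$ of the system satisfies $\tilde s_1\le s_1$, $\tilde s_2\le s_2$, $\tilde d\le d$; each quasi-homogeneous but non-homogeneous system has a unique minimal weight vector. The system is homogeneous of degree $d$ if $P(\alpha x,\alpha y)=\alpha^{d}P(x,y)$ and $Q(\alpha x,\alpha y)=\alpha^{d}Q(x,y)$ for all $\alpha>0$ (that is, $(s_1,s_2,d)$ with $s_1=s_2=1$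 is a weight vector). It is assumed (exchanging $x$ and $y$ if necessary) that $s_1>s_2$. A time rescaling here means a change of time of the form $dt=\tilde x^{k}\tilde y^{l}\,dt_1$, i.e. multiplication of the vector field by a monomial $\tilde x^{k}\tilde y^{l}$ with $k,l\ge 0$ integers (possibly $k=l=0$). *)

theory Defs
  imports "HOL-Analysis.Analysis" "HOL-Computational_Algebra.Computational_Algebra"
begin

(* Bivariate real polynomials live in (R[x])[y]: the outer variable is y and the
   coefficients are polynomials in x. *)

type_synonym poly_xy = "real poly poly"

definition eval_xy :: "poly_xy \<Rightarrow> real \<Rightarrow> real \<Rightarrow> real" where
  "eval_xy p x y = poly (poly p [:y:]) x"

(* Vanishing coefficients contribute an index j \<le> degree p, which never exceeds
   the contribution of the leading coefficient, so they do not affect the maximum. *)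
definition total_degree :: "poly_xy \<Rightarrow> nat" where
  "total_degree p = (MAX j\<in>{..degree p}. degree (coeff p j) + j)"

definition system_degree :: "poly_xy \<Rightarrow> poly_xy \<Rightarrow> nat" where
  "system_degree P Q = max (total_degree P) (total_degree Q)"

(* The units of (R[x])[y] are the nonzero constants, so coprimality says that P and Q
   have no non-constant common factor. *)
definition planar_system :: "poly_xy \<Rightarrow> poly_xy \<Rightarrow> bool" where
  "planar_system P Q \<longleftrightarrow>
     P * Q \<noteq> 0 \<and> eval_xy P 0 0 = 0 \<and> eval_xy Q 0 0 = 0 \<and> coprime P Q"

definition weight_vector :: "poly_xy \<Rightarrow> poly_xy \<Rightarrow> nat \<Rightarrow> nat \<Rightarrow> nat \<Rightarrow> bool" where
  "weight_vector P Q s1 s2 d \<longleftrightarrow>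
     0 < s1 \<and> 0 < s2 \<and> 0 < d \<and>
     (\<forall>\<alpha>>0. \<forall>x y.
        eval_xy P (\<alpha> ^ s1 * x) (\<alpha> ^ s2 * y) = \<alpha> ^ (s1 + d - 1) * eval_xy P x y \<and>
        eval_xy Q (\<alpha> ^ s1 * x) (\<alpha> ^ s2 * y) = \<alpha> ^ (s2 + d - 1) * eval_xy Q x y)"

definition quasi_homogeneous :: "poly_xy \<Rightarrow> poly_xy \<Rightarrow> bool" where
  "quasi_homogeneous P Q \<longleftrightarrow> (\<exists>s1 s2 d. weight_vector P Q s1 s2 d)"

definition minimal_weight_vector :: "poly_xy \<Rightarrow> poly_xy \<Rightarrow> nat \<Rightarrow> nat \<Rightarrow> nat \<Rightarrow> bool" where
  "minimal_weight_vector P Q s1 s2 d \<longleftrightarrow>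
     weight_vector P Q s1 s2 d \<and>
     (\<forall>t1 t2 e. weight_vector P Q t1 t2 e \<longrightarrow> s1 \<le> t1 \<and> s2 \<le> t2 \<and> d \<le> e)"

(* Equivalently, (1, 1, d) is a weight vector. *)
definition homogeneous_of_degree :: "poly_xy \<Rightarrow> poly_xy \<Rightarrow> nat \<Rightarrow> bool" where
  "homogeneous_of_degree P Q d \<longleftrightarrow>
     0 < d \<and>
     (\<forall>\<alpha>>0. \<forall>x y.
        eval_xy P (\<alpha> * x) (\<alpha> * y) = \<alpha> ^ d * eval_xy P x y \<and>
        eval_xy Q (\<alpha> * x) (\<alpha> * y) = \<alpha> ^ d * eval_xy Q x y)"

definition homogeneous :: "poly_xy \<Rightarrow> poly_xy \<Rightarrow> bool" where
  "homogeneous P Q \<longleftrightarrow> (\<exists>d. homogeneous_of_degree P Q d)"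

definition vector_field :: "poly_xy \<Rightarrow> poly_xy \<Rightarrow> real \<times> real \<Rightarrow> real \<times> real" where
  "vector_field P Q = (\<lambda>(x, y). (eval_xy P x y, eval_xy Q x y))"

(* The signs \<sigma>, \<tau> range over {1, -1}. *)
definition quadrant :: "real \<Rightarrow> real \<Rightarrow> (real \<times> real) set" where
  "quadrant \<sigma> \<tau> = {(x, y). \<sigma> * x > 0 \<and> \<tau> * y > 0}"

definition power_change :: "real \<Rightarrow> real \<Rightarrow> real \<Rightarrow> real \<Rightarrow> real \<times> real \<Rightarrow> real \<times> real" where
  "power_change \<sigma> \<tau> a b = (\<lambda>(x, y). ((\<sigma> * x) powr a, (\<tau> * y) powr b))"

(* Along solutions of z' = X z, the new variable w = \<Phi> z satisfies dw/dt = D\<Phi>(z) (X z).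
   After the time change dt = \<mu> w dt1 this reads dw/dt1 = \<mu> w D\<Phi>(z) (X z), and this is
   required to be the system dw/dt1 = Y w. *)
definition transforms_on ::
    "(real \<times> real) set \<Rightarrow> (real \<times> real \<Rightarrow> real \<times> real) \<Rightarrow> (real \<times> real \<Rightarrow> real) \<Rightarrow>
     (real \<times> real \<Rightarrow> real \<times> real) \<Rightarrow> (real \<times> real \<Rightarrow> real \<times> real) \<Rightarrow> bool" where
  "transforms_on U \<Phi> \<mu> X Y \<longleftrightarrow>
     (\<forall>z\<in>U. \<exists>D. (\<Phi> has_derivative D) (at z) \<and> \<mu> (\<Phi> z) *\<^sub>R D (X z) = Y (\<Phi> z))"

end

theory Submission imports Defs "HOL-Computational_Algebra.Field_as_Ring"
begin

text \<open>
  The weights say that the field becomes homogeneous in coordinates that scale by the same factor.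
  On a quadrant with signs \<open>\<sigma>, \<tau>\<close>, such coordinates are the \<open>u, v > 0\<close> with \<open>x = \<sigma> u\<^sup>s\<^sup>1\<close> and
  \<open>y = \<tau> v\<^sup>s\<^sup>2\<close>; this is the required change of variables with \<open>\<beta> = s\<^sub>1 s\<^sub>2\<close>. Write \<open>p\<close> and \<open>q\<close> for
  \<open>P\<close> and \<open>Q\<close> evaluated at \<open>(\<sigma> u\<^sup>s\<^sup>1, \<tau> v\<^sup>s\<^sup>2)\<close>. The chain rule gives
    \<open>du/dt = (\<sigma>/s\<^sub>1) u\<^sup>1\<^sup>-\<^sup>s\<^sup>1 p(u, v)\<close> and \<open>dv/dt = (\<tau>/s\<^sub>2) v\<^sup>1\<^sup>-\<^sup>s\<^sup>2 q(u, v)\<close>,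
  and both right-hand sides are homogeneous of degree \<open>d\<close>.

  The time rescaling by \<open>u\<^sup>k v\<^sup>l\<close> has to clear the negative exponents without creating a common
  factor. If \<open>x\<close> does not divide \<open>P\<close>, then \<open>k = s\<^sub>1 - 1\<close> turns the first component into a polynomial
  that is prime to \<open>u\<close>, so the factor \<open>u\<^sup>k\<close> that the second component acquires is harmless. If \<open>x\<close>
  divides \<open>P\<close>, then \<open>u\<^sup>s\<^sup>1\<close> divides \<open>p\<close>, nothing has to be cleared, and \<open>k = 0\<close>. The exponent \<open>l\<close>
  is found in the same way from \<open>Q\<close> and \<open>y\<close>
  (\<open>prime_power_transfer\<close>). Neither exponent depends on the signs.

  What remains is that \<open>p\<close> and \<open>q\<close> are coprime (\<open>coprime_power_subst\<close>). Eliminating \<open>y\<close> from the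
  coprime pair \<open>P, Q\<close> gives \<open>A P + B Q = r(x) \<noteq> 0\<close>, an identity that survives the substitution;
  hence a common divisor of \<open>p\<close> and \<open>q\<close> depends on \<open>u\<close> only. It then divides every coefficient of
  \<open>p\<close> and \<open>q\<close> with respect to \<open>v\<close>. Those coefficients come from the coefficients of \<open>P\<close> and \<open>Q\<close>,
  which generate the unit ideal of \<open>\<real>[x]\<close>.
\<close>

section \<open>Elimination of a variable\<close>

text \<open>By multiplicativity of the content, all of \<open>c\<close> must divide the content of the cofactor.\<close>

lemma primitive_dvd_smultD:
  fixes g p :: "'a :: {factorial_ring_gcd, semiring_gcd_mult_normalize} poly"
  assumes "content g = 1" "c \<noteq> 0" "g dvd smult c p"
  shows "g dvd p"
proof -
  obtain q where q: "smult c p = g * q" using assms(3) by (elim dvdE)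
  have "content q = normalize c * content p"
    using arg_cong[OF q, of content] assms(1) by (simp add: content_mult)
  hence "c dvd content q" by simp
  hence "[:c:] dvd q" by (simp add: const_poly_dvd_iff_dvd_content)
  then obtain q' where "q = smult c q'" by (auto elim!: dvdE)
  with q have "smult c p = smult c (g * q')" by simp
  hence "p = g * q'" using assms(2) by (metis smult_cancel)
  thus ?thesis by simp
qed

text \<open>
  A combination \<open>g\<close> of least degree pseudo-divides both polynomials without remainder, so its
  primitive part is a common divisor and hence a unit: \<open>g\<close> is constant in the main variable.
\<close>

lemma coprime_eliminant:
  fixes p q :: "'a :: {factorial_ring_gcd, semiring_gcd_mult_normalize} poly"
  assumes "coprime p q" "p \<noteq> 0"
  obtains a b r where "a * p + b * q = [:r:]" "r \<noteq> 0"
proof -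
  define I where "I = {f. \<exists>a b. f = a * p + b * q}"
  have pI: "p \<in> I" unfolding I_def by (auto intro: exI[of _ 1] exI[of _ 0])
  have qI: "q \<in> I" unfolding I_def by (auto intro: exI[of _ 1] exI[of _ 0])
  have comb: "smult c f - g * h \<in> I" if f: "f \<in> I" and g: "g \<in> I" for c f g h
  proof -
    obtain a b where "f = a * p + b * q" using f I_def by auto
    moreover obtain a' b' where "g = a' * p + b' * q" using g I_def by auto
    ultimately have "smult c f - g * h = (smult c a - a' * h) * p + (smult c b - b' * h) * q"
      by (simp add: algebra_simps smult_add_right)
    thus ?thesis unfolding I_def by blast
  qed
  obtain g where g: "g \<in> I" "g \<noteq> 0" and
    g_min: "\<And>f. f \<in> I \<Longrightarrow> f \<noteq> 0 \<Longrightarrow> degree g \<le> degree f"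
    using ex_has_least_nat[of "\<lambda>f. f \<in> I \<and> f \<noteq> 0" p degree] pI assms(2) by blast
  have pp_dvd: "primitive_part g dvd f" if f: "f \<in> I" for f
  proof -
    obtain c h where c: "c \<noteq> 0" and h: "smult c f = g * h + pseudo_mod f g"
      using pseudo_mod(1)[OF g(2), of f] by blast
    have "pseudo_mod f g = smult c f - g * h" using h by simp
    hence "pseudo_mod f g \<in> I" using comb f g(1) by simp
    hence "pseudo_mod f g = 0" using g_min pseudo_mod(2)[OF g(2), of f] by fastforce
    hence "g dvd smult c f" using h by simp
    moreover have "primitive_part g dvd g"
      by (metis content_times_primitive_part dvd_smult dvd_refl)
    ultimately have "primitive_part g dvd smult c f" using dvd_trans by blast
    thus ?thesis using primitive_dvd_smultD c g(2) content_primitive_part by blast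
  qed
  have "is_unit (primitive_part g)"
    using pp_dvd[OF pI] pp_dvd[OF qI] assms(1) coprime_common_divisor by blast
  hence "degree (primitive_part g) = 0"
    using is_unit_polyE by (metis degree_pCons_0)
  hence "degree g = 0" by simp
  then obtain r where r: "g = [:r:]" by (meson degree_eq_zeroE)
  obtain a b where "g = a * p + b * q" using g(1) I_def by auto
  hence "a * p + b * q = [:r:]" using r by metis
  moreover have "r \<noteq> 0" using r g(2) by auto
  ultimately show ?thesis by (rule that)
qed

section \<open>Bivariate real polynomials\<close>

lemma eval_xy_simps [simp]:
  "eval_xy (p + q) x y = eval_xy p x y + eval_xy q x y"
  "eval_xy (p * q) x y = eval_xy p x y * eval_xy q x y"
  "eval_xy (p ^ n) x y = eval_xy p x y ^ n"
  "eval_xy 0 x y = 0"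
  "eval_xy [:f:] x y = poly f x"
  "eval_xy [:0, 1:] x y = y"
  by (simp_all add: eval_xy_def)

text \<open>Two applications of the fact that a nonzero polynomial over a domain has finitely many roots.\<close>

lemma eval_xy_ext:
  assumes "\<And>x y. eval_xy p x y = eval_xy q x y"
  shows "p = q"
proof (rule ccontr)
  assume "p \<noteq> q"
  hence "finite {z. poly (p - q) z = 0}" by (intro poly_roots_finite) simp
  moreover have "poly (p - q) [:y:] = 0" for y
  proof -
    have "poly (poly p [:y:]) = poly (poly q [:y:])"
      using assms by (auto simp: eval_xy_def)
    thus ?thesis using poly_eq_poly_eq_iff by auto
  qed
  hence "range (\<lambda>y::real. [:y:]) \<subseteq> {z. poly (p - q) z = 0}" by auto
  ultimately have "finite (range (\<lambda>y::real. [:y:]))" using finite_subset by blast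
  moreover have "inj (\<lambda>y::real. [:y:])" by (auto simp: inj_def)
  ultimately show False using finite_imageD infinite_UNIV_char_0 by blast
qed

lemma prime_elem_x: "prime_elem ([:[:0, 1:]:] :: poly_xy)"
  by (intro lift_prime_elem_poly prime_elem_linear_field_poly) simp

lemma prime_elem_y: "prime_elem ([:0, 1:] :: poly_xy)"
  by (intro prime_elem_linear_poly) simp_all

section \<open>Substituting multiples of powers for the variables\<close>

definition power_subst :: "real \<Rightarrow> nat \<Rightarrow> real \<Rightarrow> nat \<Rightarrow> poly_xy \<Rightarrow> poly_xy" where
  "power_subst \<sigma> a \<tau> b p =
     map_poly (\<lambda>c. pcompose c (monom \<sigma> a)) (pcompose p (monom [:\<tau>:] b))"

lemma eval_power_subst [simp]:
  "eval_xy (power_subst \<sigma> a \<tau> b p) u v = eval_xy p (\<sigma> * u ^ a) (\<tau> * v ^ b)"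
proof -
  have "poly (poly (map_poly (\<lambda>c. pcompose c s) q) [:v:]) u = poly (poly q [:v:]) (poly s u)"
    for q :: poly_xy and s
    by (induction q) (auto simp: map_poly_pCons poly_pcompose)
  thus ?thesis
    by (simp add: eval_xy_def power_subst_def poly_pcompose poly_monom poly_const_pow mult.commute)
qed

lemma power_subst_add: "power_subst \<sigma> a \<tau> b (p + q) = power_subst \<sigma> a \<tau> b p + power_subst \<sigma> a \<tau> b q"
  by (rule eval_xy_ext) simp

lemma power_subst_mult: "power_subst \<sigma> a \<tau> b (p * q) = power_subst \<sigma> a \<tau> b p * power_subst \<sigma> a \<tau> b q"
  by (rule eval_xy_ext) simp

lemma power_subst_const: "power_subst \<sigma> a \<tau> b [:c:] = [:pcompose c (monom \<sigma> a):]"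
  by (rule eval_xy_ext) (simp add: poly_pcompose poly_monom)

lemma coeff_power_subst:
  assumes "b > 0"
  shows "coeff (power_subst \<sigma> a \<tau> b p) (b * j) = smult (\<tau> ^ j) (pcompose (coeff p j) (monom \<sigma> a))"
proof -
  have "coeff (pcompose p (monom [:\<tau>:] b)) (b * j) = smult (\<tau> ^ j) (coeff p j)"
  proof (induction p arbitrary: j)
    case (pCons c p)
    show ?case
    proof (cases j)
      case 0
      thus ?thesis using assms by (simp add: pcompose_pCons coeff_monom_mult)
    next
      case (Suc i)
      have "b * Suc i - b = b * i" by simp
      thus ?thesis using assms Suc pCons.IH[of i]
        by (simp add: pcompose_pCons coeff_monom_mult coeff_pCons mult.commute split: nat.splits)
    qed
  qed simp
  thus ?thesis by (simp add: power_subst_def coeff_map_poly pcompose_smult)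
qed

lemma power_subst_nonzero:
  assumes "p \<noteq> 0" "\<sigma> \<noteq> 0" "a > 0" "\<tau> \<noteq> 0" "b > 0"
  shows "power_subst \<sigma> a \<tau> b p \<noteq> 0"
proof
  assume "power_subst \<sigma> a \<tau> b p = 0"
  with coeff_power_subst[OF assms(5), of \<sigma> a \<tau> p "degree p"] assms
  have "pcompose (lead_coeff p) (monom \<sigma> a) = 0" by simp
  hence "lead_coeff p = 0" using assms by (subst (asm) pcompose_eq_0_iff) (auto simp: degree_monom_eq)
  with assms(1) show False by simp
qed

text \<open>
  The coefficients of \<open>P\<close> and \<open>Q\<close> lie in the ideal of all \<open>f\<close> whose composition with \<open>s\<close> is
  divisible by \<open>h\<close>. As \<open>\<real>[x]\<close> is principal and no polynomial in \<open>x\<close> alone divides both \<open>P\<close> and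
  \<open>Q\<close>, that ideal contains a nonzero constant.
\<close>

lemma common_coeff_divisor_is_unit:
  fixes P Q :: poly_xy and s h :: "real poly"
  assumes "coprime P Q" "P \<noteq> 0"
    and "\<And>j. h dvd pcompose (coeff P j) s" "\<And>j. h dvd pcompose (coeff Q j) s"
  shows "is_unit h"
proof -
  define J where "J = {f. h dvd pcompose f s}"
  obtain g where g: "g \<in> J" "g \<noteq> 0" and
    g_min: "\<And>f. f \<in> J \<Longrightarrow> f \<noteq> 0 \<Longrightarrow> degree g \<le> degree f"
    using ex_has_least_nat[of "\<lambda>f. f \<in> J \<and> f \<noteq> 0" "lead_coeff P" degree] assms(2,3)
    unfolding J_def by auto
  have g_dvd: "g dvd f" if "f \<in> J" for f
  proof -
    have "f mod g = f - f div g * g" by (simp add: minus_div_mult_eq_mod)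
    hence "f mod g \<in> J" using that g(1) unfolding J_def
      by (simp add: pcompose_diff pcompose_mult)
    hence "f mod g = 0" using g_min degree_mod_less[OF g(2), of f] by fastforce
    thus ?thesis by auto
  qed
  have "[:g:] dvd P" "[:g:] dvd Q"
    using g_dvd assms(3,4) unfolding J_def by (auto simp: const_poly_dvd_iff)
  hence "is_unit [:g:]" using assms(1) coprime_common_divisor by blast
  then obtain c where c: "g = [:c:]" "c \<noteq> 0"
    by (auto simp: is_unit_const_poly_iff is_unit_poly_iff dvd_field_iff)
  hence "h dvd [:c:]" using g(1) unfolding J_def by simp
  moreover have "is_unit [:c:]" using c by (simp add: is_unit_const_poly_iff dvd_field_iff)
  ultimately show ?thesis using dvd_trans by blast
qed

lemma coprime_power_subst:
  fixes P Q :: poly_xy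
  assumes "coprime P Q" "P \<noteq> 0" "\<sigma> \<noteq> 0" "a > 0" "\<tau> \<noteq> 0" "b > 0"
  shows "coprime (power_subst \<sigma> a \<tau> b P) (power_subst \<sigma> a \<tau> b Q)"
proof (rule coprimeI)
  fix h assume hP: "h dvd power_subst \<sigma> a \<tau> b P" and hQ: "h dvd power_subst \<sigma> a \<tau> b Q"
  obtain A B r where r: "A * P + B * Q = [:r:]" "r \<noteq> 0"
    using coprime_eliminant[OF assms(1,2)] by blast
  let ?r = "pcompose r (monom \<sigma> a)"
  have "[:?r:] = power_subst \<sigma> a \<tau> b A * power_subst \<sigma> a \<tau> b P
      + power_subst \<sigma> a \<tau> b B * power_subst \<sigma> a \<tau> b Q"
    by (metis r(1) power_subst_add power_subst_mult power_subst_const)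
  hence "h dvd [:?r:]" using hP hQ by simp
  moreover have "?r \<noteq> 0" using r(2) assms by (subst pcompose_eq_0_iff) (auto simp: degree_monom_eq)
  ultimately have "degree h = 0" using dvd_imp_degree_le[of h "[:?r:]"] by simp
  then obtain h0 where h0: "h = [:h0:]" by (meson degree_eq_zeroE)
  have dvd_coeff: "h0 dvd pcompose (coeff F j) (monom \<sigma> a)"
    if "h dvd power_subst \<sigma> a \<tau> b F" for F j
  proof -
    have "h0 dvd coeff (power_subst \<sigma> a \<tau> b F) (b * j)"
      using that h0 by (simp add: const_poly_dvd_iff)
    thus ?thesis using assms by (simp add: coeff_power_subst dvd_smult_iff)
  qed
  have "is_unit h0"
    using common_coeff_divisor_is_unit[OF assms(1,2)] dvd_coeff hP hQ by blast
  thus "is_unit h" using h0 by (simp add: is_unit_const_poly_iff)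
qed

text \<open>
  Divisibility by a variable is all or nothing: the power that a substituted factor produces covers
  the negative exponent \<open>1 - a\<close> coming from the chain rule.
\<close>

lemma x_dvd_power_subst_iff:
  assumes "\<sigma> \<noteq> 0" "a > 0" "\<tau> \<noteq> 0" "b > 0"
  shows "[:[:0, 1:]:] dvd power_subst \<sigma> a \<tau> b P \<longleftrightarrow> [:[:0, 1:]:] dvd P"
    and "[:[:0, 1:]:] dvd P \<Longrightarrow> [:[:0, 1:]:] ^ (a - 1) dvd power_subst \<sigma> a \<tau> b P"
proof -
  have pow: "[:[:0, 1:]:] ^ a dvd power_subst \<sigma> a \<tau> b P" if x: "[:[:0, 1:]:] dvd P"
  proof -
    obtain P1 where P1: "P = [:[:0, 1:]:] * P1" using x by (elim dvdE)
    have "power_subst \<sigma> a \<tau> b P = [:[:0, 1:]:] ^ a * ([:[:\<sigma>:]:] * power_subst \<sigma> a \<tau> b P1)"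
      by (rule eval_xy_ext) (simp add: P1 del: mult_pCons_left mult_pCons_right)
    thus ?thesis by (metis dvd_triv_left)
  qed
  show "[:[:0, 1:]:] ^ (a - 1) dvd power_subst \<sigma> a \<tau> b P" if "[:[:0, 1:]:] dvd P"
    using pow[OF that] by (meson diff_le_self dvd_trans le_imp_power_dvd)
  show "[:[:0, 1:]:] dvd power_subst \<sigma> a \<tau> b P \<longleftrightarrow> [:[:0, 1:]:] dvd P"
  proof
    assume L: "[:[:0, 1:]:] dvd power_subst \<sigma> a \<tau> b P"
    have "[:0, 1:] dvd coeff P j" for j
    proof -
      have "[:0, 1:] dvd coeff (power_subst \<sigma> a \<tau> b P) (b * j)"
        using L by (simp only: const_poly_dvd_iff)
      hence "poly (pcompose (coeff P j) (monom \<sigma> a)) 0 = 0"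
        using assms by (simp add: coeff_power_subst dvd_smult_iff dvd_iff_poly_eq_0)
      hence "poly (coeff P j) 0 = 0"
        using assms by (simp add: poly_pcompose poly_monom power_0_left)
      thus ?thesis by (simp add: dvd_iff_poly_eq_0)
    qed
    thus "[:[:0, 1:]:] dvd P" by (simp only: const_poly_dvd_iff) simp
  next
    assume "[:[:0, 1:]:] dvd P"
    thus "[:[:0, 1:]:] dvd power_subst \<sigma> a \<tau> b P"
      using pow assms(2) by (meson dvd_power dvd_trans)
  qed
qed

lemma y_dvd_power_subst_iff:
  assumes "\<sigma> \<noteq> 0" "a > 0" "\<tau> \<noteq> 0" "b > 0"
  shows "[:0, 1:] dvd power_subst \<sigma> a \<tau> b P \<longleftrightarrow> [:0, 1:] dvd P"
    and "[:0, 1:] dvd P \<Longrightarrow> [:0, 1:] ^ (b - 1) dvd power_subst \<sigma> a \<tau> b P"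
proof -
  have pow: "[:0, 1:] ^ b dvd power_subst \<sigma> a \<tau> b P" if y: "[:0, 1:] dvd P"
  proof -
    obtain P1 where P1: "P = [:0, 1:] * P1" using y by (elim dvdE)
    have "power_subst \<sigma> a \<tau> b P = [:0, 1:] ^ b * ([:[:\<tau>:]:] * power_subst \<sigma> a \<tau> b P1)"
      by (rule eval_xy_ext) (simp add: P1 del: mult_pCons_left mult_pCons_right)
    thus ?thesis by (metis dvd_triv_left)
  qed
  show "[:0, 1:] ^ (b - 1) dvd power_subst \<sigma> a \<tau> b P" if "[:0, 1:] dvd P"
    using pow[OF that] by (meson diff_le_self dvd_trans le_imp_power_dvd)
  show "[:0, 1:] dvd power_subst \<sigma> a \<tau> b P \<longleftrightarrow> [:0, 1:] dvd P"
  proof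
    assume "[:0, 1:] dvd power_subst \<sigma> a \<tau> b P"
    hence "coeff (power_subst \<sigma> a \<tau> b P) (b * 0) = 0"
      by (simp add: dvd_iff_poly_eq_0 poly_0_coeff_0)
    hence "pcompose (coeff P 0) (monom \<sigma> a) = 0"
      using assms by (subst (asm) coeff_power_subst) auto
    hence "coeff P 0 = 0"
      using assms by (subst (asm) pcompose_eq_0_iff) (auto simp: degree_monom_eq)
    thus "[:0, 1:] dvd P" by (simp add: dvd_iff_poly_eq_0 poly_0_coeff_0)
  next
    assume "[:0, 1:] dvd P"
    thus "[:0, 1:] dvd power_subst \<sigma> a \<tau> b P"
      using pow assms(4) by (meson dvd_power dvd_trans)
  qed
qed

section \<open>Clearing the negative exponents\<close>

text \<open>
  The pair \<open>(a / \<pi>\<^sup>m, b)\<close> is multiplied by the smallest power of \<open>\<pi>\<close> that makes it integral. Either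
  \<open>\<pi>\<^sup>m\<close> divides \<open>a\<close> already, or \<open>a\<close> is prime to \<open>\<pi>\<close> and the pair becomes \<open>(a, \<pi>\<^sup>m b)\<close>; both times it
  stays coprime.
\<close>

lemma prime_power_transfer:
  fixes a b \<pi> :: "'a :: factorial_ring_gcd"
  assumes "coprime a b" "prime_elem \<pi>" "\<pi> dvd a \<Longrightarrow> \<pi> ^ m dvd a"
    and "k = (if \<pi> dvd a then 0 else m)"
  obtains a' where "\<pi> ^ k * a = \<pi> ^ m * a'" "coprime a' (\<pi> ^ k * b)"
proof (cases "\<pi> dvd a")
  case True
  then obtain a' where a': "a = \<pi> ^ m * a'" using assms(3) by blast
  with assms(1) have "coprime a' b" by simp
  thus ?thesis using that[of a'] True assms(4) a' by simp
next
  case False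
  have "coprime a (\<pi> ^ m)" using prime_elem_imp_power_coprime assms(2) False by blast
  thus ?thesis using that[of a] False assms(1,4) by simp
qed

text \<open>
  Scaling the variables by \<open>\<alpha>\<close> is itself a substitution, so the scaling law is an identity between
  polynomials. There \<open>G\<close> can be cancelled, which reaches the points where \<open>G\<close> vanishes.
\<close>

lemma homogeneous_cofactor:
  assumes FG: "\<And>\<alpha> x y. \<alpha> > 0 \<Longrightarrow>
      eval_xy (G * F) (\<alpha> * x) (\<alpha> * y) = \<alpha> ^ (m + e) * eval_xy (G * F) x y"
    and G: "\<And>\<alpha> x y. \<alpha> > 0 \<Longrightarrow> eval_xy G (\<alpha> * x) (\<alpha> * y) = \<alpha> ^ m * eval_xy G x y"
    and "G \<noteq> 0" "\<alpha> > 0"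
  shows "eval_xy F (\<alpha> * x) (\<alpha> * y) = \<alpha> ^ e * eval_xy F x y"
proof -
  have "G * power_subst \<alpha> 1 \<alpha> 1 F = G * ([:[:\<alpha> ^ e:]:] * F)"
  proof (rule eval_xy_ext)
    fix x y
    have "\<alpha> ^ m * (eval_xy G x y * eval_xy F (\<alpha> * x) (\<alpha> * y))
        = \<alpha> ^ m * (\<alpha> ^ e * (eval_xy G x y * eval_xy F x y))"
      using FG[of \<alpha> x y] G[of \<alpha> x y] assms(4) by (simp add: power_add mult_ac)
    thus "eval_xy (G * power_subst \<alpha> 1 \<alpha> 1 F) x y = eval_xy (G * ([:[:\<alpha> ^ e:]:] * F)) x y"
      using assms(4) by (simp add: mult_ac del: mult_pCons_left mult_pCons_right)
  qed
  hence "power_subst \<alpha> 1 \<alpha> 1 F = [:[:\<alpha> ^ e:]:] * F" using assms(3) by (metis mult_left_cancel)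
  hence "eval_xy (power_subst \<alpha> 1 \<alpha> 1 F) x y = eval_xy ([:[:\<alpha> ^ e:]:] * F) x y" by (rule arg_cong)
  thus ?thesis by (simp del: mult_pCons_left mult_pCons_right)
qed

text \<open>A homogeneous field of positive degree vanishes at the origin.\<close>

lemma homogeneous_planar_system:
  assumes "homogeneous_of_degree P Q e" "coprime P Q" "P * Q \<noteq> 0"
  shows "planar_system P Q"
proof -
  have "eval_xy F 0 0 = 0" if "eval_xy F (2 * 0) (2 * 0) = 2 ^ e * eval_xy F 0 0" for F
  proof -
    have "(2::real) ^ e > 1" using assms(1) by (simp add: homogeneous_of_degree_def)
    thus ?thesis using that by auto
  qed
  thus ?thesis using assms unfolding planar_system_def homogeneous_of_degree_def
    by (metis zero_less_numeral)
qed

section \<open>The change of variables\<close>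

lemma power_change_has_derivative:
  assumes "\<sigma> * x > 0" "\<tau> * y > 0"
  shows "(power_change \<sigma> \<tau> a b has_derivative
     (\<lambda>(h1, h2). (a * (\<sigma> * x) powr (a - 1) * (\<sigma> * h1), b * (\<tau> * y) powr (b - 1) * (\<tau> * h2))))
     (at (x, y))"
proof -
  have "((\<lambda>z. ((\<sigma> * fst z) powr a, (\<tau> * snd z) powr b)) has_derivative
     (\<lambda>h. (a * (\<sigma> * x) powr (a - 1) * (\<sigma> * fst h), b * (\<tau> * y) powr (b - 1) * (\<tau> * snd h))))
     (at (x, y))"
    using assms
    by (auto intro!: derivative_eq_intros simp: powr_diff field_simps)
  thus ?thesis by (simp add: power_change_def case_prod_unfold)
qed

text \<open>
  With \<open>w = \<bar>x\<bar>\<close>, the last identity is the chain rule's factor: \<open>w powr (1/s - 1)\<close> is \<open>s du/dw\<close>, and in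
  the new variable it equals \<open>u\<^sup>1\<^sup>-\<^sup>s\<close>.
\<close>

lemma powr_root_identities:
  fixes w :: real
  assumes "w > 0" "s > 0"
  defines "u \<equiv> w powr (1 / real s)"
  shows "u > 0" "u ^ s = w" "w powr (1 / real s - 1) * u ^ (s - 1) = 1"
proof -
  show u: "u > 0" using assms by simp
  show us: "u ^ s = w" using assms by (simp add: u_def powr_realpow[symmetric] powr_powr)
  have "w powr (1 / real s - 1) = u / w" using assms by (simp add: powr_diff)
  moreover have "u * u ^ (s - 1) = w" using us assms(2) by (metis power_eq_if not_gr_zero)
  ultimately show "w powr (1 / real s - 1) * u ^ (s - 1) = 1" using assms by simp
qed

text \<open>
  The hypotheses on \<open>P0\<close> and \<open>Q0\<close> say that the chain rule's \<open>u\<^sup>1\<^sup>-\<^sup>a\<close> and \<open>v\<^sup>1\<^sup>-\<^sup>b\<close> are absorbed by the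
  rescaling \<open>u\<^sup>k v\<^sup>l\<close>.
\<close>

lemma power_change_transforms:
  assumes "\<sigma> \<in> {1, -1}" "\<tau> \<in> {1, -1}" "a > 0" "b > 0"
    and P0: "[:[:0, 1:]:] ^ k * power_subst \<sigma> a \<tau> b P = [:[:0, 1:]:] ^ (a - 1) * P0"
    and Q0: "[:0, 1:] ^ l * ([:[:0, 1:]:] ^ k * power_subst \<sigma> a \<tau> b Q) = [:0, 1:] ^ (b - 1) * Q0"
  shows "transforms_on (quadrant \<sigma> \<tau>) (power_change \<sigma> \<tau> (1 / real a) (1 / real b))
     (\<lambda>(u, v). u ^ k * v ^ l) (vector_field P Q)
     (vector_field ([:[:\<sigma> / real a:]:] * ([:0, 1:] ^ l * P0)) ([:[:\<tau> / real b:]:] * Q0))"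
  unfolding transforms_on_def
proof safe
  fix x y assume "(x, y) \<in> quadrant \<sigma> \<tau>"
  hence pos: "\<sigma> * x > 0" "\<tau> * y > 0" by (auto simp: quadrant_def)
  define u v where "u = (\<sigma> * x) powr (1 / real a)" and "v = (\<tau> * y) powr (1 / real b)"
  define Du Dv where "Du = (\<sigma> * x) powr (1 / real a - 1)" and "Dv = (\<tau> * y) powr (1 / real b - 1)"
  note u = powr_root_identities[OF pos(1) assms(3), folded u_def, folded Du_def]
  note v = powr_root_identities[OF pos(2) assms(4), folded v_def, folded Dv_def]
  have x: "\<sigma> * u ^ a = x" and y: "\<tau> * v ^ b = y" using assms(1,2) u(2) v(2) by auto
  have eP: "u ^ k * eval_xy P x y = u ^ (a - 1) * eval_xy P0 u v"
    using arg_cong[OF P0, of "\<lambda>p. eval_xy p u v"] by (simp add: x y)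
  have eQ: "v ^ l * (u ^ k * eval_xy Q x y) = v ^ (b - 1) * eval_xy Q0 u v"
    using arg_cong[OF Q0, of "\<lambda>p. eval_xy p u v"] by (simp add: x y)
  have 1: "u ^ k * v ^ l * (1 / real a * Du * (\<sigma> * eval_xy P x y))
      = \<sigma> / real a * (v ^ l * eval_xy P0 u v)"
  proof -
    have "u ^ k * v ^ l * (1 / real a * Du * (\<sigma> * eval_xy P x y))
        = \<sigma> / real a * v ^ l * Du * (u ^ k * eval_xy P x y)" by (simp add: mult_ac)
    also have "\<dots> = \<sigma> / real a * (v ^ l * eval_xy P0 u v) * (Du * u ^ (a - 1))"
      unfolding eP by (simp only: mult_ac)
    finally show ?thesis by (simp only: u(3) mult_1_right)
  qed
  have 2: "u ^ k * v ^ l * (1 / real b * Dv * (\<tau> * eval_xy Q x y)) = \<tau> / real b * eval_xy Q0 u v"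
  proof -
    have "u ^ k * v ^ l * (1 / real b * Dv * (\<tau> * eval_xy Q x y))
        = \<tau> / real b * Dv * (v ^ l * (u ^ k * eval_xy Q x y))" by (simp add: mult_ac)
    also have "\<dots> = \<tau> / real b * eval_xy Q0 u v * (Dv * v ^ (b - 1))"
      unfolding eQ by (simp only: mult_ac)
    finally show ?thesis by (simp only: v(3) mult_1_right)
  qed
  have uv: "power_change \<sigma> \<tau> (1 / real a) (1 / real b) (x, y) = (u, v)"
    by (simp add: power_change_def u_def v_def)
  show "\<exists>D. (power_change \<sigma> \<tau> (1 / real a) (1 / real b) has_derivative D) (at (x, y)) \<and>
      (case power_change \<sigma> \<tau> (1 / real a) (1 / real b) (x, y) of (u, v) \<Rightarrow> u ^ k * v ^ l) *\<^sub>R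
        D (vector_field P Q (x, y)) =
      vector_field ([:[:\<sigma> / real a:]:] * ([:0, 1:] ^ l * P0)) ([:[:\<tau> / real b:]:] * Q0)
        (power_change \<sigma> \<tau> (1 / real a) (1 / real b) (x, y))"
    using power_change_has_derivative[OF pos, of "1 / real a" "1 / real b", folded Du_def Dv_def]
    by (intro exI conjI, assumption)
      (simp only: uv vector_field_def prod.case scaleR_Pair real_scaleR_def eval_xy_simps poly_pCons poly_0
        mult_zero_right add_0_right 1 2)
qed

text \<open>
  Both components of the new field have degree \<open>d + k + l\<close>: the weights \<open>s\<^sub>1 + d - 1\<close> and \<open>s\<^sub>2 + d - 1\<close>
  of \<open>P\<close> and \<open>Q\<close> become ordinary degrees, and \<open>s\<^sub>1 - 1\<close> and \<open>s\<^sub>2 - 1\<close> of them are divided away.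
\<close>

lemma rescaled_system_homogeneous:
  assumes "weight_vector P Q s1 s2 d" "c \<noteq> 0" "c' \<noteq> 0"
    and P0: "[:[:0, 1:]:] ^ k * power_subst \<sigma> s1 \<tau> s2 P = [:[:0, 1:]:] ^ (s1 - 1) * P0"
    and Q0: "[:0, 1:] ^ l * ([:[:0, 1:]:] ^ k * power_subst \<sigma> s1 \<tau> s2 Q) = [:0, 1:] ^ (s2 - 1) * Q0"
  shows "homogeneous_of_degree ([:[:c:]:] * ([:0, 1:] ^ l * P0)) ([:[:c':]:] * Q0) (d + k + l)"
proof -
  note w = assms(1)[unfolded weight_vector_def]
  have scale: "\<sigma> * (\<alpha> * x) ^ s1 = \<alpha> ^ s1 * (\<sigma> * x ^ s1)" "\<tau> * (\<alpha> * x) ^ s2 = \<alpha> ^ s2 * (\<tau> * x ^ s2)"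
    for \<alpha> x by (simp_all add: power_mult_distrib mult_ac)
  have hP: "eval_xy P0 (\<alpha> * x) (\<alpha> * y) = \<alpha> ^ (d + k) * eval_xy P0 x y" if "\<alpha> > 0" for \<alpha> x y
  proof (rule homogeneous_cofactor[where G = "[:[:0, 1:]:] ^ (s1 - 1)" and m = "s1 - 1"])
    fix \<beta> x y :: real assume "\<beta> > 0"
    have e: "k + (s1 + d - 1) = s1 - 1 + (d + k)" using w by simp
    have "eval_xy P (\<beta> ^ s1 * (\<sigma> * x ^ s1)) (\<beta> ^ s2 * (\<tau> * y ^ s2))
        = \<beta> ^ (s1 + d - 1) * eval_xy P (\<sigma> * x ^ s1) (\<tau> * y ^ s2)"
      using w \<open>\<beta> > 0\<close> by blast
    thus "eval_xy ([:[:0, 1:]:] ^ (s1 - 1) * P0) (\<beta> * x) (\<beta> * y)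
        = \<beta> ^ (s1 - 1 + (d + k)) * eval_xy ([:[:0, 1:]:] ^ (s1 - 1) * P0) x y"
      unfolding P0[symmetric] e[symmetric]
      by (simp add: scale power_add power_mult_distrib mult_ac)
  qed (use that in \<open>auto simp: power_mult_distrib\<close>)
  have hQ: "eval_xy Q0 (\<alpha> * x) (\<alpha> * y) = \<alpha> ^ (d + k + l) * eval_xy Q0 x y" if "\<alpha> > 0" for \<alpha> x y
  proof (rule homogeneous_cofactor[where G = "[:0, 1:] ^ (s2 - 1)" and m = "s2 - 1"])
    fix \<beta> x y :: real assume "\<beta> > 0"
    have e: "l + (k + (s2 + d - 1)) = s2 - 1 + (d + k + l)" using w by simp
    have "eval_xy Q (\<beta> ^ s1 * (\<sigma> * x ^ s1)) (\<beta> ^ s2 * (\<tau> * y ^ s2))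
        = \<beta> ^ (s2 + d - 1) * eval_xy Q (\<sigma> * x ^ s1) (\<tau> * y ^ s2)"
      using w \<open>\<beta> > 0\<close> by blast
    thus "eval_xy ([:0, 1:] ^ (s2 - 1) * Q0) (\<beta> * x) (\<beta> * y)
        = \<beta> ^ (s2 - 1 + (d + k + l)) * eval_xy ([:0, 1:] ^ (s2 - 1) * Q0) x y"
      unfolding Q0[symmetric] e[symmetric]
      by (simp add: scale power_add power_mult_distrib mult_ac)
  qed (use that in \<open>auto simp: power_mult_distrib\<close>)
  show ?thesis unfolding homogeneous_of_degree_def
    using w by (auto simp: hP hQ power_add power_mult_distrib mult_ac
        simp del: mult_pCons_left mult_pCons_right)
qed

theorem theorem1:
  fixes P Q :: poly_xy and n s1 s2 d :: nat
  assumes "planar_system P Q"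
    and "system_degree P Q = n"
    and "quasi_homogeneous P Q"
    and "\<not> homogeneous P Q"
    and "minimal_weight_vector P Q s1 s2 d"
    and "s1 > s2"
  shows "\<exists>\<beta>::nat. \<beta> > 0 \<and>
    (\<exists>k l :: nat. \<forall>\<sigma>\<in>{1, -1}. \<forall>\<tau>\<in>{1, -1}. \<exists>P' Q'.
       planar_system P' Q' \<and> homogeneous P' Q' \<and>
       transforms_on (quadrant \<sigma> \<tau>)
         (power_change \<sigma> \<tau> (real s2 / real \<beta>) (real s1 / real \<beta>))
         (\<lambda>(u, v). u ^ k * v ^ l)
         (vector_field P Q) (vector_field P' Q'))"
proof -
  have w: "weight_vector P Q s1 s2 d" using assms(5) by (simp add: minimal_weight_vector_def)
  hence s: "s1 > 0" "s2 > 0" by (simp_all add: weight_vector_def)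
  have cop: "coprime P Q" and nz: "P \<noteq> 0" "Q \<noteq> 0" using assms(1) by (auto simp: planar_system_def)
  define k where "k = (if [:[:0, 1:]:] dvd P then 0 else s1 - 1)"
  define l where "l = (if [:0, 1:] dvd Q then 0 else s2 - 1)"
  have exponents: "real s2 / real (s1 * s2) = 1 / real s1" "real s1 / real (s1 * s2) = 1 / real s2"
    using s by simp_all
  have new_system: "\<exists>P' Q'. planar_system P' Q' \<and> homogeneous P' Q' \<and>
       transforms_on (quadrant \<sigma> \<tau>) (power_change \<sigma> \<tau> (1 / real s1) (1 / real s2))
         (\<lambda>(u, v). u ^ k * v ^ l) (vector_field P Q) (vector_field P' Q')"
    if sg: "\<sigma> \<in> {1, -1}" "\<tau> \<in> {1, -1}" for \<sigma> \<tau>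
  proof -
    have nz': "\<sigma> \<noteq> 0" "\<tau> \<noteq> 0" using sg by auto
    note args = nz'(1) s(1) nz'(2) s(2)
    let ?P = "power_subst \<sigma> s1 \<tau> s2 P" and ?Q = "power_subst \<sigma> s1 \<tau> s2 Q"
    obtain P0 where P0: "[:[:0, 1:]:] ^ k * ?P = [:[:0, 1:]:] ^ (s1 - 1) * P0"
      and cop1: "coprime P0 ([:[:0, 1:]:] ^ k * ?Q)"
    proof (rule prime_power_transfer[OF coprime_power_subst[OF cop nz(1) args] prime_elem_x])
      show "[:[:0, 1:]:] ^ (s1 - 1) dvd ?P" if "[:[:0, 1:]:] dvd ?P"
        using that x_dvd_power_subst_iff[OF args, of P] by blast
      show "k = (if [:[:0, 1:]:] dvd ?P then 0 else s1 - 1)"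
        unfolding k_def x_dvd_power_subst_iff(1)[OF args, of P] ..
    qed
    \<comment> \<open>This makes the choice of \<open>l\<close> independent of \<open>k\<close> and of the signs.\<close>
    have y_dvd: "[:0, 1:] dvd [:[:0, 1:]:] ^ k * ?Q \<longleftrightarrow> [:0, 1:] dvd Q"
    proof -
      have "\<not> [:0, 1:] dvd ([:[:0, 1:]:] :: poly_xy)" by (simp add: dvd_iff_poly_eq_0)
      hence "\<not> [:0, 1:] dvd ([:[:0, 1:]:] :: poly_xy) ^ k"
        using prime_elem_dvd_power[OF prime_elem_y] by blast
      thus ?thesis using y_dvd_power_subst_iff(1)[OF args, of Q]
        by (simp add: prime_elem_dvd_mult_iff[OF prime_elem_y])
    qed
    obtain Q0 where Q0: "[:0, 1:] ^ l * ([:[:0, 1:]:] ^ k * ?Q) = [:0, 1:] ^ (s2 - 1) * Q0"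
      and cop2: "coprime Q0 ([:0, 1:] ^ l * P0)"
    proof (rule prime_power_transfer[OF _ prime_elem_y])
      show "coprime ([:[:0, 1:]:] ^ k * ?Q) P0" using cop1 by (simp add: coprime_commute)
      show "[:0, 1:] ^ (s2 - 1) dvd [:[:0, 1:]:] ^ k * ?Q" if "[:0, 1:] dvd [:[:0, 1:]:] ^ k * ?Q"
        using that y_dvd y_dvd_power_subst_iff(2)[OF args, of Q] by (intro dvd_mult) blast
      show "l = (if [:0, 1:] dvd [:[:0, 1:]:] ^ k * ?Q then 0 else s2 - 1)"
        unfolding l_def y_dvd ..
    qed
    have "P0 \<noteq> 0" using P0 power_subst_nonzero[OF nz(1) args] by auto
    have "Q0 \<noteq> 0" using Q0 power_subst_nonzero[OF nz(2) args] by auto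
    define P' Q' where "P' = [:[:\<sigma> / real s1:]:] * ([:0, 1:] ^ l * P0)"
      and "Q' = [:[:\<tau> / real s2:]:] * Q0"
    have units: "is_unit ([:[:\<sigma> / real s1:]:] :: poly_xy)" "is_unit ([:[:\<tau> / real s2:]:] :: poly_xy)"
      using nz' s by (simp_all add: is_unit_const_poly_iff dvd_field_iff)
    have "coprime ([:0, 1:] ^ l * P0) Q0" using cop2 by (simp only: coprime_commute)
    hence "coprime P' Q'"
      unfolding P'_def Q'_def
      by (simp only: coprime_mult_left_iff coprime_mult_right_iff simp_thms
          is_unit_left_imp_coprime[OF units(1)] is_unit_right_imp_coprime[OF units(2)])
    moreover have "P' * Q' \<noteq> 0"
      using \<open>P0 \<noteq> 0\<close> \<open>Q0 \<noteq> 0\<close> nz' s unfolding P'_def Q'_def by simp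
    moreover have hom: "homogeneous_of_degree P' Q' (d + k + l)"
      unfolding P'_def Q'_def
      by (rule rescaled_system_homogeneous[OF w _ _ P0 Q0]) (use nz' s in auto)
    ultimately have "planar_system P' Q'" by (rule homogeneous_planar_system[rotated])
    moreover have "homogeneous P' Q'" using hom by (auto simp: homogeneous_def)
    moreover note power_change_transforms[OF sg s P0 Q0, folded P'_def Q'_def]
    ultimately show ?thesis by blast
  qed
  show ?thesis
  proof (rule exI[of _ "s1 * s2"], rule conjI)
    show "s1 * s2 > 0" using s by simp
  qed (unfold exponents, rule exI[of _ k], rule exI[of _ l], intro ballI, rule new_system)
qed

end
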